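(* Let $\mathbb{F}_q$ be a finite field with $q$ elements and let $L$ be a three-dimensional Lie algebra over $\mathbb{F}_q$ with $\dim L'=2$. Put $V=L'$ and suppose that for some $x\in L\setminus L'$ the characteristic polynomial of the restriction $\operatorname{ad} x|_V : V\to V$ is irreducible over $\mathbb{F}_q$. Then the number of triangles in the comaximal graph $\Gamma(L)$ is $$\mathfrak{t}(\Gamma(L)) = \frac{q^2(q^2-1)(q^2+3q+4)}{6}.$$
   Context: For a finite-dimensional Lie algebra $L$, $L'=[L,L]$ is the derived algebra. The comaximal graph $\Gamma(L)$ is the simple undirected graph whose vertices are the proper nonzero Lie subalgebras of $L$; two distinct vertices $A,B$ are adjacent if and only if the Lie subalgebra $\langle A,B\rangle$ generated by $A\cup B$ equals $L$. A triangle of a graph is a set of three pairwise adjacent vertices, and $\mathfrak{t}(\Gamma)$ denotes the number of triangles of $\Gamma$. *)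

theory Defs
  imports "Jordan_Normal_Form.Char_Poly"
begin

text \<open>
  The Lie algebra is a whole type, as in the vector space locale of the library.  The bracket is
  required to be alternating (not merely antisymmetric), which matters in characteristic 2.
\<close>

locale lie_algebra = vector_space scale
  for scale :: "'k::field \<Rightarrow> 'v::ab_group_add \<Rightarrow> 'v" +
  fixes bracket :: "'v \<Rightarrow> 'v \<Rightarrow> 'v"
  assumes linear_bracket_left: "\<And>y. Vector_Spaces.linear scale scale (\<lambda>x. bracket x y)"
    and linear_bracket_right: "\<And>x. Vector_Spaces.linear scale scale (\<lambda>y. bracket x y)"
    and bracket_self: "\<And>x. bracket x x = 0"
    and jacobi: "\<And>x y z.
      bracket x (bracket y z) + bracket y (bracket z x) + bracket z (bracket x y) = 0"
begin

definition lie_subalgebra :: "'v set \<Rightarrow> bool" where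
  "lie_subalgebra A \<longleftrightarrow> subspace A \<and> (\<forall>x\<in>A. \<forall>y\<in>A. bracket x y \<in> A)"

definition generated_subalgebra :: "'v set \<Rightarrow> 'v set" where
  "generated_subalgebra S = lie_subalgebra hull S"

definition derived_algebra :: "'v set" where
  "derived_algebra = span {bracket x y | x y. True}"

definition ad :: "'v \<Rightarrow> 'v \<Rightarrow> 'v" where
  "ad x = (\<lambda>y. bracket x y)"

definition comaximal_vertices :: "'v set set" where
  "comaximal_vertices = {A. lie_subalgebra A \<and> A \<noteq> {0} \<and> A \<noteq> UNIV}"

definition comaximal_edges :: "'v set set set" where
  "comaximal_edges = {{A, B} | A B. A \<in> comaximal_vertices \<and> B \<in> comaximal_vertices \<and>
     A \<noteq> B \<and> generated_subalgebra (A \<union> B) = UNIV}"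

definition comaximal_graph :: "'v set set \<times> 'v set set set" where
  "comaximal_graph = (comaximal_vertices, comaximal_edges)"

definition ordered_basis_of :: "'v set \<Rightarrow> 'v list \<Rightarrow> bool" where
  "ordered_basis_of V bs \<longleftrightarrow> distinct bs \<and> independent (set bs) \<and> span (set bs) = V"

definition matrix_wrt :: "'v list \<Rightarrow> ('v \<Rightarrow> 'v) \<Rightarrow> 'k mat" where
  "matrix_wrt bs f = mat (length bs) (length bs)
     (\<lambda>(i, j). representation (set bs) (f (bs ! j)) (bs ! i))"

text \<open>
  The characteristic polynomial of the restriction of \<open>f\<close> to \<open>V\<close>, for a finite-dimensional
  subspace \<open>V\<close> that is mapped into itself by the linear map \<open>f\<close>.  The result does not depend on
  the chosen basis, since matrices in different bases are similar.
\<close>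

definition char_poly_on :: "'v set \<Rightarrow> ('v \<Rightarrow> 'v) \<Rightarrow> 'k poly" where
  "char_poly_on V f = char_poly (matrix_wrt (SOME bs. ordered_basis_of V bs) f)"

end

text \<open>A simple graph is given by its vertex set and its set of two-element edges.\<close>

definition triangles :: "'a set \<times> 'a set set \<Rightarrow> 'a set set" where
  "triangles G = {T. T \<subseteq> fst G \<and> card T = 3 \<and> (\<forall>a\<in>T. \<forall>b\<in>T. a \<noteq> b \<longrightarrow> {a, b} \<in> snd G)}"

definition num_triangles :: "'a set \<times> 'a set set \<Rightarrow> nat" where
  "num_triangles G = card (triangles G)"

end

theory Submission
  imports Defs
begin

text \<open>
  Irreducibility means that \<open>ad x\<close> has no eigenvector in \<open>V\<close>.  As \<open>ad x\<close> is a derivation, it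
  preserves the line or zero space \<open>[V, V]\<close>, so \<open>V\<close> is abelian, and then no \<open>ad y\<close> with \<open>y \<notin> V\<close> has
  an eigenvector in \<open>V\<close>.  Hence a proper subalgebra that is not inside \<open>V\<close> is a line meeting \<open>V\<close> only
  in \<open>0\<close>.  So \<open>\<Gamma>(L)\<close> is the join of the complete graph on these \<open>q\<^sup>2\<close> lines with the edgeless
  graph on the \<open>q + 2\<close> nonzero subspaces of \<open>V\<close>, and a triangle has at most one vertex in the latter.
\<close>

section \<open>Binomial coefficients over the reals and triangles in a join of graphs\<close>

lemma real_choose_2: "real (n choose 2) = real n * (real n - 1) / 2"
  by (induction n) (simp_all add: numeral_2_eq_2 field_simps)

lemma real_choose_3: "real (n choose 3) = real n * (real n - 1) * (real n - 2) / 6"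
proof (induction n)
  case (Suc n)
  have "Suc n choose 3 = (n choose 2) + (n choose 3)"
    by (simp add: numeral_3_eq_3 numeral_2_eq_2)
  then show ?case
    using Suc by (simp add: real_choose_2 field_simps)
qed simp

text \<open>The only missing edges are those inside \<open>I\<close>, so a triangle is either a
  3-subset of \<open>C\<close> or a 2-subset of \<open>C\<close> together with one vertex of
  \<open>I\<close>. These two families are disjoint and are counted separately.\<close>

lemma num_triangles_join:
  assumes fin: "finite C" "finite I" and disj: "C \<inter> I = {}"
    and edges: "E = {{A, B} | A B. A \<in> C \<union> I \<and> B \<in> C \<union> I \<and> A \<noteq> B \<and> \<not> (A \<in> I \<and> B \<in> I)}"
  shows "num_triangles (C \<union> I, E) = (card C choose 3) + (card C choose 2) * card I"
proof -
  let ?T1 = "{T. T \<subseteq> C \<and> card T = 3}"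
  let ?P = "{T. T \<subseteq> C \<and> card T = 2} \<times> I"
  let ?T2 = "(\<lambda>(S, i). insert i S) ` ?P"
  have edge_iff: "{A, B} \<in> E \<longleftrightarrow> \<not> (A \<in> I \<and> B \<in> I)"
    if "A \<in> C \<union> I" "B \<in> C \<union> I" "A \<noteq> B" for A B
    using that unfolding edges by (auto simp: doubleton_eq_iff)
  have "triangles (C \<union> I, E) = ?T1 \<union> ?T2"
  proof (intro equalityI subsetI)
    fix T assume "T \<in> triangles (C \<union> I, E)"
    then have T: "T \<subseteq> C \<union> I" "card T = 3"
      and adj: "\<And>a b. \<lbrakk>a \<in> T; b \<in> T; a \<noteq> b\<rbrakk> \<Longrightarrow> {a, b} \<in> E"
      by (auto simp: triangles_def)
    \<comment> \<open>Two distinct vertices of \<open>T\<close> in \<open>I\<close> would need an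
      edge that \<open>E\<close> excludes.\<close>
    have one: "a = b" if "a \<in> T" "b \<in> T" "a \<in> I" "b \<in> I" for a b
      using adj[of a b] edge_iff[of a b] that T(1) by blast
    show "T \<in> ?T1 \<union> ?T2"
    proof (cases "T \<subseteq> C")
      case False
      then obtain i where i: "i \<in> T" "i \<in> I" "i \<notin> C"
        using T(1) by blast
      have "T - {i} \<subseteq> C" "card (T - {i}) = 2" "T = insert i (T - {i})"
        using T one i by (auto simp: card_Diff_singleton_if)
      then show ?thesis
        using i by (intro UnI2 image_eqI[of _ _ "(T - {i}, i)"]) auto
    qed (use T in auto)
  next
    fix T assume T: "T \<in> ?T1 \<union> ?T2"
    then have "T \<subseteq> C \<union> I" by auto
    moreover have "card T = 3"
    proof (cases "T \<in> ?T1")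
      case False
      then obtain S i where S: "T = insert i S" "S \<subseteq> C" "card S = 2" "i \<in> I"
        using T by auto
      moreover have "i \<notin> S" "finite S"
        using S disj fin by (auto intro: finite_subset)
      ultimately show ?thesis by simp
    qed simp
    moreover have "\<not> (a \<in> I \<and> b \<in> I)" if "a \<in> T" "b \<in> T" "a \<noteq> b" for a b
      using T that disj by auto
    ultimately show "T \<in> triangles (C \<union> I, E)"
      unfolding triangles_def using edge_iff by (simp add: subset_iff)
  qed
  moreover have "?T1 \<inter> ?T2 = {}"
    using disj by auto
  moreover have "inj_on (\<lambda>(S, i). insert i S) ?P"
  proof (rule inj_onI, clarify)
    fix S i S' i'
    assume *: "S \<subseteq> C" "S' \<subseteq> C" "i \<in> I" "i' \<in> I" "insert i S = insert i' S'"
    \<comment> \<open>Since \<open>C\<close> and \<open>I\<close> are disjoint, intersecting the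
      triangle with each of them recovers the pair \<open>S\<close> and the vertex
      \<open>i\<close>.\<close>
    have "S = insert i S \<inter> C" "S' = insert i' S' \<inter> C"
      using * disj by auto
    moreover have "{i} = insert i S \<inter> I" "{i'} = insert i' S' \<inter> I"
      using * disj by auto
    ultimately show "S = S' \<and> i = i'"
      using *(5) by (metis singleton_inject)
  qed
  then have "card ?T2 = (card C choose 2) * card I"
    by (simp add: card_image card_cartesian_product n_subsets fin)
  ultimately show ?thesis
    using fin by (simp add: num_triangles_def card_Un_disjoint n_subsets)
qed

section \<open>Irreducible polynomials, basic Lie algebra facts and eigenvectors\<close>

lemma irreducible_poly_no_root:
  fixes p :: "'a::field poly"
  assumes irr: "irreducible p" and deg: "degree p \<noteq> 1"
  shows "poly p c \<noteq> 0"
proof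
  assume "poly p c = 0"
  then obtain r where r: "p = [:- c, 1:] * r"
    by (auto simp: poly_eq_0_iff_dvd elim: dvdE)
  have "\<not> is_unit [:- c, 1:]"
    by (auto simp: is_unit_iff_degree)
  then have "is_unit r"
    using irreducibleD[OF irr r] by blast
  then have "degree r = 0" "r \<noteq> 0"
    by (auto simp: is_unit_iff_degree)
  then have "degree p = 1"
    unfolding r by (subst degree_mult_eq) auto
  with deg show False by simp
qed

context lie_algebra
begin

lemma module_hom_bracket:
  "module_hom scale scale (\<lambda>x. bracket x y)" "module_hom scale scale (bracket x)"
  using linear_bracket_left linear_bracket_right by (auto simp: linear_iff_module_hom)

lemmas bracket_simps =
  module_hom.add[OF module_hom_bracket(1)] module_hom.add[OF module_hom_bracket(2)]
  module_hom.scale[OF module_hom_bracket(1)] module_hom.scale[OF module_hom_bracket(2)]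
  module_hom.zero[OF module_hom_bracket(1)] module_hom.zero[OF module_hom_bracket(2)]
  module_hom.neg[OF module_hom_bracket(1)] module_hom.neg[OF module_hom_bracket(2)]
  bracket_self

lemma bracket_commute: "bracket x y = - bracket y x"
proof -
  have "bracket (x + y) (x + y) = bracket x y + bracket y x"
    \<comment> \<open>Additivity is applied first, because \<open>bracket_self\<close> could
      otherwise collapse the left-hand side to 0 before it is expanded.\<close>
    by (simp only: bracket_simps(1,2), simp add: bracket_self)
  then have "bracket x y + bracket y x = 0" using bracket_self[of "x + y"] by argo
  then show ?thesis by (simp add: eq_neg_iff_add_eq_0)
qed

lemma bracket_in_derived_algebra: "bracket y z \<in> derived_algebra"
  unfolding derived_algebra_def by (rule span_base) blast

lemma lie_subalgebra_span_singleton: "lie_subalgebra (span {v})"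
  unfolding lie_subalgebra_def
proof (intro conjI ballI)
  fix y z assume "y \<in> span {v}" "z \<in> span {v}"
  then have "bracket y z = 0" by (auto simp: span_singleton bracket_simps)
  then show "bracket y z \<in> span {v}" by (simp add: span_zero)
qed (rule subspace_span)

lemma lie_subalgebra_generated: "lie_subalgebra (generated_subalgebra S)"
  unfolding generated_subalgebra_def
  by (rule hull_in) (auto simp: lie_subalgebra_def intro: subspace_Inter)

lemma subset_generated: "S \<subseteq> generated_subalgebra S"
  unfolding generated_subalgebra_def by (rule hull_subset)

lemma generated_minimal: "\<lbrakk>S \<subseteq> A; lie_subalgebra A\<rbrakk> \<Longrightarrow> generated_subalgebra S \<subseteq> A"
  unfolding generated_subalgebra_def by (rule hull_minimal)

lemma span_singleton_scale: "c \<noteq> 0 \<Longrightarrow> span {scale c v} = span {v}"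
  using span_eq[of "{scale c v}" "{v}"] span_scale[of v "{v}" c] span_base[of v "{v}"]
    span_scale[of "scale c v" "{scale c v}" "inverse c"] span_base[of "scale c v" "{scale c v}"]
  by auto

text \<open>The coordinate vector \<open>?w\<close> of \<open>v\<close> is an eigenvector of the
  matrix, because column \<open>j\<close> of the matrix holds the coordinates of the image of
  \<open>bs ! j\<close>. This carries eigenvectors of \<open>f\<close> in \<open>V\<close> over to
  the matrix theory behind \<open>char_poly\<close>.\<close>

lemma eigenvalue_matrix_wrt:
  assumes bs: "ordered_basis_of V bs" and lin: "Vector_Spaces.linear scale scale f"
    and inv: "f ` V \<subseteq> V" and v: "v \<in> V" "v \<noteq> 0" and eig: "f v = scale c v"
  shows "eigenvalue (matrix_wrt bs f) c"
proof -
  interpret f: Vector_Spaces.linear scale scale f by (rule lin)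
  let ?B = "set bs" and ?n = "length bs"
  let ?r = "representation (set bs)"
  let ?w = "vec ?n (\<lambda>i. ?r v (bs ! i))"
  have dist: "distinct bs" and ind: "independent ?B" and sp: "span ?B = V"
    using bs by (auto simp: ordered_basis_of_def)
  have nth_sum: "(\<Sum>j<?n. g (bs ! j)) = sum g ?B" for g :: "'v \<Rightarrow> 'k"
    using sum.reindex_bij_betw[OF bij_betw_nth[OF dist refl refl], of g] by simp
  have expand: "v = (\<Sum>b\<in>?B. scale (?r v b) b)"
    by (rule sum_representation_eq[symmetric]) (use ind sp v in auto)
  have ne: "?w \<noteq> 0\<^sub>v ?n"
  proof
    assume w: "?w = 0\<^sub>v ?n"
    have "?r v b = 0" if "b \<in> ?B" for b
      using that w by (auto simp: in_set_conv_nth vec_eq_iff)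
    then have "v = 0" by (subst expand) (simp add: sum.neutral)
    with v show False by simp
  qed
  \<comment> \<open>\<open>representation\<close> is constantly 0 outside the span, so it is
    additive here only because \<open>f\<close> maps the basis into \<open>V\<close>.\<close>
  have fB: "f b \<in> span ?B" if "b \<in> ?B" for b
    using inv sp that span_base[of b ?B] by auto
  have "f v = (\<Sum>b\<in>?B. scale (?r v b) (f b))"
    by (subst expand) (simp add: f.sum f.scale)
  then have r: "?r (f v) = (\<lambda>i. \<Sum>b\<in>?B. ?r v b * ?r (f b) i)"
    by (simp add: representation_sum[OF ind] representation_scale[OF ind] fB span_scale)
  have "?r (f v) i = c * ?r v i" for i
    unfolding eig using v sp by (simp add: representation_scale[OF ind])
  then have key: "(\<Sum>b\<in>?B. ?r v b * ?r (f b) i) = c * ?r v i" for i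
    using r by metis
  have "matrix_wrt bs f *\<^sub>v ?w = c \<cdot>\<^sub>v ?w"
  proof (rule eq_vecI)
    fix i assume "i < dim_vec (c \<cdot>\<^sub>v ?w)"
    then have i: "i < ?n" by simp
    have "(matrix_wrt bs f *\<^sub>v ?w) $ i = (\<Sum>j<?n. ?r v (bs ! j) * ?r (f (bs ! j)) (bs ! i))"
      using i by (simp add: matrix_wrt_def scalar_prod_def lessThan_atLeast0 mult.commute)
    also have "\<dots> = (\<Sum>b\<in>?B. ?r v b * ?r (f b) (bs ! i))"
      by (rule nth_sum)
    finally show "(matrix_wrt bs f *\<^sub>v ?w) $ i = (c \<cdot>\<^sub>v ?w) $ i"
      using i by (simp add: key)
  qed (simp add: matrix_wrt_def)
  then have "eigenvector (matrix_wrt bs f) ?w c"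
    using ne by (auto simp: eigenvector_def matrix_wrt_def)
  then show ?thesis by (auto simp: eigenvalue_def)
qed

text \<open>An eigenvalue would be a root of the characteristic polynomial, whose degree is
  \<open>dim V\<close>, and an irreducible polynomial of degree at least 2 has no root.\<close>

lemma no_eigenvector:
  assumes irr: "irreducible (char_poly_on V f)"
    and V: "subspace V" "dim V \<ge> 2" and lin: "Vector_Spaces.linear scale scale f"
    and inv: "f ` V \<subseteq> V" and v: "v \<in> V" "f v = scale c v"
  shows "v = 0"
proof (rule ccontr)
  assume v0: "v \<noteq> 0"
  obtain B where B: "B \<subseteq> V" "independent B" "V \<subseteq> span B" "card B = dim V"
    by (rule basis_exists)
  \<comment> \<open>An infinite set has \<open>card\<close> 0, so positive dimension forces a finite
    basis.\<close>
  have "finite B" using B V by (intro card_ge_0_finite) simp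
  moreover have "span B = V" using B V by (intro span_subspace)
  ultimately have "\<exists>bs. ordered_basis_of V bs"
    using B finite_distinct_list[of B] by (auto simp: ordered_basis_of_def)
  \<comment> \<open>The list that \<open>char_poly_on\<close> picks with \<open>SOME\<close> is a
    genuine basis, since one exists.\<close>
  then have bs: "ordered_basis_of V (SOME bs. ordered_basis_of V bs)" (is "ordered_basis_of V ?bs")
    by (rule someI_ex)
  have "dim V = length ?bs"
    using bs dim_unique[of "set ?bs" V] distinct_card[of ?bs] span_superset[of "set ?bs"]
    by (auto simp: ordered_basis_of_def)
  moreover have M: "matrix_wrt ?bs f \<in> carrier_mat (length ?bs) (length ?bs)"
    by (simp add: matrix_wrt_def)
  ultimately have "degree (char_poly_on V f) \<noteq> 1"
    using V degree_monic_char_poly[OF M] by (simp add: char_poly_on_def)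
  moreover have "poly (char_poly_on V f) c = 0"
    using eigenvalue_matrix_wrt[OF bs lin inv v(1) v0 v(2)] eigenvalue_root_char_poly[OF M]
    by (simp add: char_poly_on_def)
  ultimately show False
    using irreducible_poly_no_root[OF irr] by blast
qed

end

section \<open>Structure of the algebra and its subalgebras\<close>

locale irreducible_plane_algebra = lie_algebra scale bracket
  for scale :: "'k::field \<Rightarrow> 'v::ab_group_add \<Rightarrow> 'v" and bracket +
  fixes V :: "'v set" and x a b :: 'v
  assumes bracket_in_V: "bracket y z \<in> V"
    and V_eq_span: "V = span {a, b}"
    and a_notin: "a \<notin> span {b}"
    and b_nonzero: "b \<noteq> 0"
    and x_notin_V: "x \<notin> V"
    and diff_x_in_V: "\<exists>c. y - scale c x \<in> V"
    and ad_x_no_eigenvector: "\<lbrakk>v \<in> V; bracket x v = scale c v\<rbrakk> \<Longrightarrow> v = 0"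
begin

lemma subspace_V: "subspace V"
  by (simp add: V_eq_span)

lemma in_V_iff: "v \<in> V \<longleftrightarrow> (\<exists>\<alpha> \<beta>. v = scale \<alpha> a + scale \<beta> b)"
  by (simp add: V_eq_span span_breakdown_eq[of _ a] span_singleton image_iff diff_eq_eq
      add.commute)

lemma coords_zero: "scale \<alpha> a + scale \<beta> b = 0 \<longleftrightarrow> \<alpha> = 0 \<and> \<beta> = 0"
proof
  assume *: "scale \<alpha> a + scale \<beta> b = 0"
  have "\<alpha> = 0"
  proof (rule ccontr)
    assume "\<alpha> \<noteq> 0"
    have "scale \<alpha> a = scale (- \<beta>) b"
      using * by (simp add: add_eq_0_iff2)
    then have "scale (inverse \<alpha>) (scale \<alpha> a) = scale (inverse \<alpha>) (scale (- \<beta>) b)"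
      by simp
    then have "a = scale (inverse \<alpha> * - \<beta>) b"
      using \<open>\<alpha> \<noteq> 0\<close> by (simp only: scale_scale) simp
    then show False
      using a_notin unfolding span_singleton by blast
  qed
  with * b_nonzero show "\<alpha> = 0 \<and> \<beta> = 0" by simp
qed simp

lemma coords_unique:
  "scale \<alpha> a + scale \<beta> b = scale \<alpha>' a + scale \<beta>' b \<longleftrightarrow> \<alpha> = \<alpha>' \<and> \<beta> = \<beta>'"
  using coords_zero[of "\<alpha> - \<alpha>'" "\<beta> - \<beta>'"] by (auto simp: algebra_simps)

text \<open>Every bracket of elements of \<open>V\<close> is a multiple of
  \<open>bracket a b\<close>. The Jacobi identity makes this vector satisfy an eigenvector equation
  for \<open>ad x\<close>, so it vanishes.\<close>

lemma V_abelian: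
  assumes "u \<in> V" "v \<in> V"
  shows "bracket u v = 0"
proof -
  let ?e = "bracket a b"
  have line: "\<exists>d. bracket u v = scale d ?e" if "u \<in> V" "v \<in> V" for u v
  proof -
    obtain \<alpha> \<beta> \<gamma> \<delta> where "u = scale \<alpha> a + scale \<beta> b" "v = scale \<gamma> a + scale \<delta> b"
      using \<open>u \<in> V\<close> \<open>v \<in> V\<close> by (auto simp: in_V_iff)
    \<comment> \<open>The coefficient is the determinant of the coordinates of \<open>u\<close> and
      \<open>v\<close>.\<close>
    then have "bracket u v = scale (\<alpha> * \<delta> - \<beta> * \<gamma>) ?e"
      using bracket_commute[of b a] by (simp add: bracket_simps algebra_simps)
    then show ?thesis ..
  qed
  have ab: "a \<in> V" "b \<in> V"
    by (auto simp: V_eq_span intro: span_base)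
  obtain c d where cd: "bracket a (bracket b x) = scale c ?e" "bracket b (bracket x a) = scale d ?e"
    using line ab bracket_in_V by meson
  have "bracket x ?e = scale (- c - d) ?e"
    using jacobi[of x a b] cd by (simp add: algebra_simps eq_neg_iff_add_eq_0)
  then have "?e = 0"
    using ad_x_no_eigenvector bracket_in_V by blast
  then show ?thesis
    using line[OF assms] by auto
qed

text \<open>Modulo \<open>V\<close>, \<open>y\<close> is a nonzero multiple of \<open>x\<close>. As
  \<open>V\<close> acts trivially on itself, \<open>ad y\<close> and \<open>ad x\<close> are
  proportional on \<open>V\<close>.\<close>

lemma ad_no_eigenvector:
  assumes y: "y \<notin> V" and v: "v \<in> V" and eig: "bracket y v = scale c v"
  shows "v = 0"
proof -
  obtain d where d: "y - scale d x \<in> V" using diff_x_in_V by blast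
  have "d \<noteq> 0" using d y by auto
  have "bracket y v = bracket (y - scale d x) v + bracket (scale d x) v"
    by (simp flip: bracket_simps(1))
  then have "scale d (bracket x v) = scale c v"
    using V_abelian[OF d v] eig by (simp add: bracket_simps)
  then have "scale (inverse d) (scale d (bracket x v)) = scale (inverse d) (scale c v)"
    by simp
  then have "bracket x v = scale (inverse d * c) v"
    using \<open>d \<noteq> 0\<close> by simp
  then show ?thesis
    using ad_x_no_eigenvector v by blast
qed

text \<open>A vector of \<open>V\<close> outside the span would give three independent vectors in
  the span of \<open>a\<close> and \<open>b\<close>.\<close>

lemma V_subset_span:
  assumes "v \<in> V" "w \<in> V" "v \<noteq> 0" "w \<notin> span {v}"
  shows "V \<subseteq> span {w, v}"
proof
  fix z assume "z \<in> V"
  show "z \<in> span {w, v}"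
  proof (rule ccontr)
    assume z: "z \<notin> span {w, v}"
    have "independent {w, v}" "w \<noteq> v"
      using assms span_base[of v "{v}"] by (auto simp: independent_insert)
    moreover have "z \<notin> {w, v}" using z by (auto intro: span_base)
    ultimately have "independent {z, w, v}" "card {z, w, v} = 3"
      using z by (auto simp: independent_insert[of z])
    then show False
      using independent_span_bound[of "{a, b}" "{z, w, v}"] assms \<open>z \<in> V\<close>
      by (auto simp: V_eq_span card_insert_if split: if_splits)
  qed
qed

lemma subspace_of_V_cases:
  assumes A: "subspace A" "A \<subseteq> V" "A \<noteq> {0}"
  shows "A = V \<or> (\<exists>v\<in>V. v \<noteq> 0 \<and> A = span {v})"
proof -
  obtain v where v: "v \<in> A" "v \<noteq> 0"
    using A subspace_0 by auto
  then have "span {v} \<subseteq> A"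
    using A by (intro span_minimal) auto
  show ?thesis
  proof (cases "A \<subseteq> span {v}")
    case True
    then show ?thesis using \<open>span {v} \<subseteq> A\<close> v A by blast
  next
    case False
    then obtain w where w: "w \<in> A" "w \<notin> span {v}" by blast
    have "V \<subseteq> span {w, v}"
      using v w A by (intro V_subset_span) auto
    also have "\<dots> \<subseteq> A"
      using v w A by (intro span_minimal) auto
    finally show ?thesis using A by blast
  qed
qed

text \<open>If \<open>A\<close> meets \<open>V\<close> only in 0, then \<open>A\<close> embeds in
  the one-dimensional quotient by \<open>V\<close> and is a line. Otherwise it contains some nonzero
  \<open>v\<close> in \<open>V\<close>; then \<open>v\<close> and \<open>bracket y v\<close> span
  \<open>V\<close>, and adding \<open>y\<close> gives everything.\<close>

lemma subalgebra_not_in_V: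
  assumes A: "lie_subalgebra A" and y: "y \<in> A" "y \<notin> V"
  shows "A = UNIV \<or> A = span {y}"
proof -
  have sub: "subspace A" and closed: "\<And>u v. \<lbrakk>u \<in> A; v \<in> A\<rbrakk> \<Longrightarrow> bracket u v \<in> A"
    using A by (auto simp: lie_subalgebra_def)
  obtain d where d: "y - scale d x \<in> V" using diff_x_in_V by blast
  have d0: "d \<noteq> 0" using d y by auto
  have decomp: "\<exists>c. z - scale c y \<in> V" for z
  proof -
    obtain e where e: "z - scale e x \<in> V" using diff_x_in_V by blast
    have "z - scale (e / d) y = (z - scale e x) - scale (e / d) (y - scale d x)"
      using d0 by (simp add: algebra_simps)
    then show ?thesis
      using e d subspace_V by (metis subspace_diff subspace_scale)
  qed
  show ?thesis
  proof (cases "A \<inter> V \<subseteq> {0}")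
    case True
    have "z \<in> span {y}" if "z \<in> A" for z
    proof -
      obtain c where c: "z - scale c y \<in> V" using decomp by blast
      have "z - scale c y \<in> A"
        using that y sub by (intro subspace_diff subspace_scale)
      then have "z = scale c y" using c True by auto
      then show ?thesis by (auto simp: span_singleton)
    qed
    moreover have "span {y} \<subseteq> A"
      using y sub by (intro span_minimal) auto
    ultimately show ?thesis by blast
  next
    case False
    then obtain v where v: "v \<in> A" "v \<in> V" "v \<noteq> 0" by blast
    have "bracket y v \<notin> span {v}"
      using ad_no_eigenvector[OF y(2) v(2)] v(3) by (auto simp: span_singleton)
    then have "V \<subseteq> span {bracket y v, v}"
      using v bracket_in_V by (intro V_subset_span)
    also have "\<dots> \<subseteq> A"
      using sub v y closed by (intro span_minimal) auto
    finally have VA: "V \<subseteq> A" .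
    have "z \<in> A" for z
    proof -
      obtain c where "z - scale c y \<in> V" using decomp by blast
      then have "(z - scale c y) + scale c y \<in> A"
        using VA y sub by (intro subspace_add subspace_scale) auto
      then show ?thesis by simp
    qed
    then show ?thesis by blast
  qed
qed

lemma lie_subalgebra_subset_V: "A \<subseteq> V \<Longrightarrow> lie_subalgebra A \<longleftrightarrow> subspace A"
  by (auto simp: lie_subalgebra_def V_abelian subset_iff subspace_0)

section \<open>The vertices and edges of the comaximal graph\<close>

definition outer_lines :: "'v set set" where
  "outer_lines = {span {y} | y. y \<notin> V}"

text \<open>The independent part of the join. It contains \<open>V\<close> itself besides the lines
  in \<open>V\<close>.\<close>

definition V_subspaces :: "'v set set" where
  "V_subspaces = {A. subspace A \<and> A \<subseteq> V \<and> A \<noteq> {0}}"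

lemma outer_lines_not_subset: "A \<in> outer_lines \<Longrightarrow> \<not> A \<subseteq> V"
  by (auto simp: outer_lines_def dest: subsetD[OF _ span_base[of _ "{_}"]])

lemma span_outer_not_UNIV:
  assumes "y \<notin> V"
  shows "span {y} \<noteq> UNIV"
proof
  assume *: "span {y} = UNIV"
  have "b \<in> span {y}" using * by simp
  then obtain c where c: "b = scale c y" by (auto simp: span_singleton)
  then have "c \<noteq> 0" using b_nonzero by auto
  have "scale (inverse c) b \<in> V"
    by (auto simp: V_eq_span intro: span_scale span_base)
  then show False using c \<open>c \<noteq> 0\<close> assms by simp
qed

lemma comaximal_vertices_eq: "comaximal_vertices = outer_lines \<union> V_subspaces"
proof (intro equalityI subsetI)
  fix A assume "A \<in> comaximal_vertices"
  then have A: "lie_subalgebra A" "A \<noteq> {0}" "A \<noteq> UNIV"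
    by (auto simp: comaximal_vertices_def)
  show "A \<in> outer_lines \<union> V_subspaces"
  proof (cases "A \<subseteq> V")
    case True
    then show ?thesis using A lie_subalgebra_subset_V by (auto simp: V_subspaces_def)
  next
    case False
    then obtain y where "y \<in> A" "y \<notin> V" by blast
    then show ?thesis
      using subalgebra_not_in_V[OF A(1)] A(3) by (auto simp: outer_lines_def)
  qed
next
  fix A assume "A \<in> outer_lines \<union> V_subspaces"
  then show "A \<in> comaximal_vertices"
  proof
    assume A: "A \<in> outer_lines"
    then obtain y where y: "A = span {y}" "y \<notin> V" by (auto simp: outer_lines_def)
    have "A \<noteq> {0}"
      using outer_lines_not_subset[OF A] subspace_0[OF subspace_V] by auto
    then show ?thesis
      using y span_outer_not_UNIV lie_subalgebra_span_singleton
      by (auto simp: comaximal_vertices_def)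
  next
    assume "A \<in> V_subspaces"
    then show ?thesis
      using lie_subalgebra_subset_V x_notin_V
      by (auto simp: V_subspaces_def comaximal_vertices_def)
  qed
qed

text \<open>Two subalgebras inside \<open>V\<close> generate at most \<open>V\<close>. Otherwise the
  generated algebra has an element outside \<open>V\<close>, so it is everything or a line, and a
  line cannot contain two distinct vertices.\<close>

lemma generated_eq_UNIV_iff:
  assumes A: "A \<in> comaximal_vertices" and B: "B \<in> comaximal_vertices" and "A \<noteq> B"
  shows "generated_subalgebra (A \<union> B) = UNIV \<longleftrightarrow> \<not> (A \<subseteq> V \<and> B \<subseteq> V)"
proof
  assume *: "generated_subalgebra (A \<union> B) = UNIV"
  show "\<not> (A \<subseteq> V \<and> B \<subseteq> V)"
  proof
    assume "A \<subseteq> V \<and> B \<subseteq> V"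
    then have "generated_subalgebra (A \<union> B) \<subseteq> V"
      using lie_subalgebra_subset_V[of V] subspace_V by (intro generated_minimal) auto
    then show False using * x_notin_V by auto
  qed
next
  assume *: "\<not> (A \<subseteq> V \<and> B \<subseteq> V)"
  let ?G = "generated_subalgebra (A \<union> B)"
  have sub: "A \<subseteq> ?G" "B \<subseteq> ?G" using subset_generated[of "A \<union> B"] by auto
  then obtain y where y: "y \<in> ?G" "y \<notin> V" using * by blast
  show "?G = UNIV"
  proof (rule ccontr)
    assume "?G \<noteq> UNIV"
    then have G: "?G = span {y}"
      using subalgebra_not_in_V[OF lie_subalgebra_generated y] by blast
    \<comment> \<open>A line has no nonzero subspace but itself; applied to \<open>A\<close> and
      \<open>B\<close> this contradicts their being distinct.\<close>
    have "C = span {y}" if C: "C \<in> comaximal_vertices" "C \<subseteq> ?G" for C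
    proof -
      have C': "subspace C" "C \<noteq> {0}"
        using C by (auto simp: comaximal_vertices_def lie_subalgebra_def)
      then obtain v where v: "v \<in> C" "v \<noteq> 0"
        using subspace_0 by auto
      then obtain c where c: "v = scale c y"
        using C G by (auto simp: span_singleton)
      then have "span {v} = span {y}"
        using v span_singleton_scale[of c y] by auto
      moreover have "span {v} \<subseteq> C"
        using v C' by (intro span_minimal) auto
      ultimately show ?thesis using C G by auto
    qed
    then show False using A B sub \<open>A \<noteq> B\<close> by blast
  qed
qed

lemma subset_V_iff: "A \<in> comaximal_vertices \<Longrightarrow> A \<subseteq> V \<longleftrightarrow> A \<in> V_subspaces"
  using comaximal_vertices_eq outer_lines_not_subset by (auto simp: V_subspaces_def)

text \<open>This is the shape of edge set that \<open>num_triangles_join\<close> expects.\<close>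

lemma comaximal_edges_eq:
  "comaximal_edges = {{A, B} | A B. A \<in> outer_lines \<union> V_subspaces \<and> B \<in> outer_lines \<union> V_subspaces
     \<and> A \<noteq> B \<and> \<not> (A \<in> V_subspaces \<and> B \<in> V_subspaces)}"
proof -
  have "A \<in> comaximal_vertices \<and> B \<in> comaximal_vertices \<and> A \<noteq> B \<and>
      generated_subalgebra (A \<union> B) = UNIV \<longleftrightarrow>
    A \<in> comaximal_vertices \<and> B \<in> comaximal_vertices \<and> A \<noteq> B \<and>
      \<not> (A \<in> V_subspaces \<and> B \<in> V_subspaces)" for A B
    using generated_eq_UNIV_iff[of A B] subset_V_iff[of A] subset_V_iff[of B] by blast
  then show ?thesis
    unfolding comaximal_edges_def comaximal_vertices_eq[symmetric] by simp
qed

section \<open>Counting the vertices of both kinds\<close>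

lemma card_V: "card V = (card (UNIV :: 'k set))\<^sup>2"
proof -
  have "bij_betw (\<lambda>(\<alpha>, \<beta>). scale \<alpha> a + scale \<beta> b) UNIV V"
    unfolding bij_betw_def by (auto simp: inj_on_def coords_unique in_V_iff image_iff)
  then have "card (UNIV :: ('k \<times> 'k) set) = card V"
    by (rule bij_betw_same_card)
  then show ?thesis
    by (simp add: card_cartesian_product power2_eq_square flip: UNIV_Times_UNIV)
qed

text \<open>Each line not inside \<open>V\<close> meets the coset of \<open>x\<close> modulo
  \<open>V\<close> in exactly one point.\<close>

lemma bij_betw_outer_lines: "bij_betw (\<lambda>v. span {x + v}) V outer_lines"
  unfolding bij_betw_def
proof
  show "inj_on (\<lambda>v. span {x + v}) V"
  proof
    fix v w assume v: "v \<in> V" and w: "w \<in> V" and eq: "span {x + v} = span {x + w}"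
    have "x + v \<in> span {x + w}"
      using eq span_base[of "x + v" "{x + v}"] by simp
    then obtain c where c: "x + v = scale c (x + w)" by (auto simp: span_singleton)
    \<comment> \<open>Otherwise comparing both sides modulo \<open>V\<close> puts a nonzero multiple
      of \<open>x\<close> into \<open>V\<close>.\<close>
    have "c = 1"
    proof (rule ccontr)
      assume "c \<noteq> 1"
      have "scale (1 - c) x = scale c w - v"
        using c by (simp add: algebra_simps)
      moreover have "\<dots> \<in> V"
        using v w subspace_V by (intro subspace_diff subspace_scale)
      ultimately have "scale (inverse (1 - c)) (scale (1 - c) x) \<in> V"
        using subspace_V by (metis subspace_scale)
      then show False using \<open>c \<noteq> 1\<close> x_notin_V by simp
    qed
    then show "v = w" using c by simp
  qed
  show "(\<lambda>v. span {x + v}) ` V = outer_lines"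
  proof (intro equalityI subsetI)
    fix A assume "A \<in> (\<lambda>v. span {x + v}) ` V"
    then obtain v where v: "v \<in> V" "A = span {x + v}" by blast
    moreover have "x + v \<notin> V"
      using v x_notin_V subspace_diff[OF subspace_V, of "x + v" v] by auto
    ultimately show "A \<in> outer_lines" by (auto simp: outer_lines_def)
  next
    fix A assume "A \<in> outer_lines"
    then obtain y where y: "A = span {y}" "y \<notin> V" by (auto simp: outer_lines_def)
    obtain d where d: "y - scale d x \<in> V" using diff_x_in_V by blast
    have "d \<noteq> 0" using d y by auto
    \<comment> \<open>Scaling \<open>y\<close> by the inverse of \<open>d\<close> moves it into the
      coset of \<open>x\<close>; \<open>?v\<close> is its difference from \<open>x\<close>.\<close>
    let ?v = "scale (inverse d) (y - scale d x)"
    have "x + ?v = scale (inverse d) y"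
      using \<open>d \<noteq> 0\<close> by (simp add: scale_right_diff_distrib)
    then have "span {x + ?v} = A"
      using y \<open>d \<noteq> 0\<close> span_singleton_scale[of "inverse d" y] by simp
    moreover have "?v \<in> V" using d subspace_V by (intro subspace_scale)
    ultimately show "A \<in> (\<lambda>v. span {x + v}) ` V" by blast
  qed
qed

lemma card_outer_lines: "card outer_lines = (card (UNIV :: 'k set))\<^sup>2"
  using bij_betw_same_card[OF bij_betw_outer_lines] card_V by simp

text \<open>The lines in \<open>V\<close> form a projective line: \<open>span {b}\<close> is the
  point at infinity and \<open>c\<close> is the affine coordinate of the others.\<close>

lemma V_subspaces_eq:
  "V_subspaces = insert V (insert (span {b}) (range (\<lambda>c. span {a + scale c b})))"
proof (intro equalityI subsetI)
  fix A assume "A \<in> V_subspaces"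
  then consider "A = V" | v where "v \<in> V" "v \<noteq> 0" "A = span {v}"
    using subspace_of_V_cases by (auto simp: V_subspaces_def)
  then show "A \<in> insert V (insert (span {b}) (range (\<lambda>c. span {a + scale c b})))"
  proof cases
    case 2
    then obtain \<alpha> \<beta> where v: "v = scale \<alpha> a + scale \<beta> b" by (auto simp: in_V_iff)
    show ?thesis
    proof (cases "\<alpha> = 0")
      case True
      then show ?thesis using 2 v by (auto simp: span_singleton_scale)
    next
      case False
      then have "v = scale \<alpha> (a + scale (\<beta> / \<alpha>) b)"
        using v by (simp add: algebra_simps)
      then show ?thesis using 2 False by (auto simp: span_singleton_scale)
    qed
  qed simp
next
  have line: "span {v} \<in> V_subspaces" if "v \<in> V" "v \<noteq> 0" for v
    using that subspace_V span_minimal[of "{v}" V] span_base[of v "{v}"]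
    by (auto simp: V_subspaces_def)
  have "b \<in> V" by (auto simp: V_eq_span intro: span_base)
  moreover have "a + scale c b \<in> V" "a + scale c b \<noteq> 0" for c
    using coords_zero[of 1 c] in_V_iff scale_one by (metis, simp)
  moreover have "V \<in> V_subspaces"
    using \<open>b \<in> V\<close> b_nonzero subspace_V by (auto simp: V_subspaces_def)
  moreover fix A assume "A \<in> insert V (insert (span {b}) (range (\<lambda>c. span {a + scale c b})))"
  ultimately show "A \<in> V_subspaces"
    using line b_nonzero by auto
qed

lemma card_V_subspaces:
  assumes "finite (UNIV :: 'k set)"
  shows "finite V_subspaces" "card V_subspaces = card (UNIV :: 'k set) + 2"
proof -
  have inj: "inj (\<lambda>c. span {a + scale c b})"
  proof
    fix c d assume "span {a + scale c b} = span {a + scale d b}"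
    then have "a + scale c b \<in> span {a + scale d b}"
      using span_base[of "a + scale c b" "{a + scale c b}"] by simp
    then obtain k where "a + scale c b = scale k (a + scale d b)"
      by (auto simp: span_singleton)
    \<comment> \<open>The coefficient of \<open>a\<close> forces \<open>k\<close> to be 1, and then
      that of \<open>b\<close> gives the claim.\<close>
    then have "scale 1 a + scale c b = scale k a + scale (k * d) b"
      by (simp add: algebra_simps)
    then show "c = d" unfolding coords_unique by simp
  qed
  have b_line: "a + scale c b \<notin> span {b}" for c
  proof
    assume "a + scale c b \<in> span {b}"
    moreover have "scale c b \<in> span {b}"
      by (intro span_scale span_base) simp
    ultimately have "a + scale c b - scale c b \<in> span {b}"
      by (rule span_diff)
    then show False using a_notin by simp
  qed
  then have 1: "span {b} \<notin> range (\<lambda>c. span {a + scale c b})"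
    using span_base[of "a + scale _ b" "{a + scale _ b}"] by blast
  have "V \<noteq> span {v}" for v
  proof
    assume "V = span {v}"
    then obtain k l where k: "a = scale k v" and l: "b = scale l v"
      using span_base[of a "{a, b}"] span_base[of b "{a, b}"]
      by (auto simp: V_eq_span span_singleton)
    \<comment> \<open>Two multiples of one vector satisfy this relation, so independence gives
      \<open>l = 0\<close>, contradicting \<open>b_nonzero\<close>.\<close>
    then have "scale l a + scale (- k) b = 0"
      by (simp add: mult.commute)
    then show False
      unfolding coords_zero using l b_nonzero by simp
  qed
  then have 2: "V \<notin> insert (span {b}) (range (\<lambda>c. span {a + scale c b}))"
    by auto
  show "finite V_subspaces" "card V_subspaces = card (UNIV :: 'k set) + 2"
    using 1 2 assms card_image[OF inj] by (simp_all add: V_subspaces_eq)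
qed

theorem num_triangles_comaximal_graph:
  assumes fin: "finite (UNIV :: 'k set)"
  defines "q \<equiv> card (UNIV :: 'k set)"
  shows "num_triangles comaximal_graph = (q\<^sup>2 choose 3) + (q\<^sup>2 choose 2) * (q + 2)"
proof -
  have "card outer_lines = q\<^sup>2" "q > 0"
    using fin by (auto simp: card_outer_lines q_def finite_UNIV_card_ge_0)
  then have "finite outer_lines"
    by (intro card_ge_0_finite) simp
  moreover have "outer_lines \<inter> V_subspaces = {}"
    using outer_lines_not_subset by (auto simp: V_subspaces_def)
  ultimately show ?thesis
    using num_triangles_join[OF _ card_V_subspaces(1)[OF fin] _ comaximal_edges_eq]
      card_V_subspaces(2)[OF fin] card_outer_lines
    by (simp add: comaximal_graph_def comaximal_vertices_eq q_def)
qed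

end

theorem proposition3p7:
  fixes scale :: "'k::{field,finite} \<Rightarrow> 'v::ab_group_add \<Rightarrow> 'v"
    and bracket :: "'v \<Rightarrow> 'v \<Rightarrow> 'v"
    and q :: nat
    and V :: "'v set"
  assumes q: "q = card (UNIV :: 'k set)"
    and L: "lie_algebra scale bracket"
    and dim_L: "vector_space.dim scale (UNIV :: 'v set) = 3"
    and V: "V = lie_algebra.derived_algebra scale bracket"
    and dim_V: "vector_space.dim scale V = 2"
    and irred: "\<exists>x. x \<notin> V \<and>
      irreducible (lie_algebra.char_poly_on scale V (lie_algebra.ad bracket x))"
  shows "real (num_triangles (lie_algebra.comaximal_graph scale bracket)) =
    (real q)^2 * ((real q)^2 - 1) * ((real q)^2 + 3 * real q + 4) / 6"
proof -
  interpret lie_algebra scale bracket by (rule L)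
  obtain x where x: "x \<notin> V" "irreducible (char_poly_on V (ad x))"
    using irred by blast
  have sub: "subspace V" unfolding V derived_algebra_def by (rule subspace_span)
  have in_V: "bracket y z \<in> V" for y z
    unfolding V by (rule bracket_in_derived_algebra)
  obtain B where B: "B \<subseteq> V" "independent B" "V \<subseteq> span B" "card B = dim V"
    by (rule basis_exists)
  obtain a b where ab: "B = {a, b}" "a \<noteq> b"
    using B dim_V by (auto simp: card_2_iff)
  have V_span: "V = span {a, b}"
    using B ab sub span_subspace by blast
  have ind: "a \<notin> span {b}" "b \<noteq> 0"
    using B ab by (auto simp: independent_insert)
  obtain C where C: "independent C" "UNIV \<subseteq> span C" "card C = 3"
    using basis_exists[of UNIV] dim_L by metis
  have "finite C" using C by (intro card_ge_0_finite) simp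
  \<comment> \<open>A vector outside this span would yield four independent vectors in dimension
    3.\<close>
  have span_UNIV: "y \<in> span {x, a, b}" for y
  proof (rule ccontr)
    assume y: "y \<notin> span {x, a, b}"
    have "x \<notin> {a, b}"
      using x V_span span_base by blast
    then have "independent {x, a, b}" "card {x, a, b} = 3"
      using B ab x V_span by (auto simp: independent_insert[of x])
    moreover have "y \<notin> {x, a, b}" using y span_superset[of "{x, a, b}"] by auto
    ultimately have "independent {y, x, a, b}" "card {y, x, a, b} = 4"
      using y by (auto simp: independent_insert[of y])
    then show False
      using independent_span_bound[OF \<open>finite C\<close>, of "{y, x, a, b}"] C by auto
  qed
  \<comment> \<open>From here on, irreducibility enters only through the absence of eigenvectors of
    \<open>ad x\<close> in \<open>V\<close>.\<close>
  interpret irreducible_plane_algebra scale bracket V x a b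
  proof
    show "\<exists>c. y - scale c x \<in> V" for y
      using span_UNIV[of y] by (simp add: span_breakdown_eq[of y x] V_span)
    show "v = 0" if "v \<in> V" "bracket x v = scale c v" for v c
      using no_eigenvector[OF x(2) sub _ _ _ that(1), of c] that dim_V linear_bracket_right in_V
      by (auto simp: ad_def)
  qed (use in_V V_span ind x in auto)
  have "real (num_triangles comaximal_graph) =
      real (q\<^sup>2 choose 3) + real (q\<^sup>2 choose 2) * (real q + 2)"
    using num_triangles_comaximal_graph by (simp add: q algebra_simps)
  \<comment> \<open>With \<open>n\<close> the square of \<open>q\<close>, the factor
    \<open>n * (n - 1) / 6\<close> comes out and leaves \<open>(n - 2) + 3 * (q + 2)\<close>, which
    is \<open>n + 3 * q + 4\<close>.\<close>
  then show ?thesis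
    by (simp add: real_choose_2 real_choose_3 field_simps)
qed

end
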